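(* Let $\gamma_{s,\lambda}^\star(P,Q):=\inf\{\gamma\in[0,1]:P\preceq_{s,\lambda,\gamma}^{\rm CSD}Q\}$, with $\inf\varnothing:=+\infty$. Then $$\gamma_{s,\lambda}^\star(P,Q)=\begin{cases}0,& W_s(P,Q)=0,\\[1mm] \dfrac{W_s(P,Q)-\Delta_s(P,Q)}{W_s(P,Q)+\Delta_s(P,Q)},& W_s(P,Q)>0\text{ and }\Delta_s(P,Q)\ge0,\\[3mm] +\infty,&\Delta_s(P,Q)<0.\end{cases}$$
   Context: Let $D\subseteq\mathbb R^d$ be a nonempty Borel set; $P,Q$ are Borel probability measures supported on $D$ (i.e. $P(D)=Q(D)=1$) with finite first moments. $\mathcal C(P,Q)$ is the set of couplings of $P$ and $Q$ (first marginal $P$, second marginal $Q$), and $t_+:=\max\{t,0\}$. Let $(\Theta,\mathscr A,\lambda)$ be a finite measure space and $s:\Theta\times\mathbb R^d\to\mathbb R$ jointly measurable; write $s_\theta(x):=s(\theta,x)$. Standing assumptions: each $s_\theta$ is coordinatewise nondecreasing, $\int_\Theta|s_\theta(0)|\,\lambda(d\theta)<\infty$, and for some finite constant $\overline L_s$, $\int_\Theta|s_\theta(x)-s_\theta(y)|\,\lambda(d\theta)\le\overline L_s\|x-y\|_1$ for all $x,y\in\mathbb R^d$. Define $S(x):=\int_\Theta s_\theta(x)\,\lambda(d\theta)$, $d_s(x,y):=\int_\Theta|s_\theta(x)-s_\theta(y)|\,\lambda(d\theta)$, $W_s(P,Q):=\inf_{\kappa\in\mathcal C(P,Q)}\int_{D\times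 D}d_s\,d\kappa$, and $\Delta_s(P,Q):=\int_D S\,dQ-\int_D S\,dP$. Compensated stochastic dominance (CSD): for $\gamma\in[0,1]$, $P\preceq_{s,\lambda,\gamma}^{\rm CSD}Q$ means that there exists $\kappa\in\mathcal C(P,Q)$ with $$\int_{D\times D}\int_\Theta(s_\theta(x)-s_\theta(y))_+\,\lambda(d\theta)\,\kappa(dx,dy)\le\gamma\int_{D\times D}\int_\Theta(s_\theta(y)-s_\theta(x))_+\,\lambda(d\theta)\,\kappa(dx,dy).$$ *)

theory Defs
  imports "HOL-Probability.Probability"
begin

definition l1_norm :: "real ^ 'n \<Rightarrow> real" where
  "l1_norm x = (\<Sum>i\<in>UNIV. \<bar>x $ i\<bar>)"

definition couplings :: "'a measure \<Rightarrow> 'b measure \<Rightarrow> ('a \<times> 'b) measure set" where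
  "couplings P Q = {\<kappa>. prob_space \<kappa> \<and> sets \<kappa> = sets (P \<Otimes>\<^sub>M Q) \<and>
     distr \<kappa> P fst = P \<and> distr \<kappa> Q snd = Q}"

text \<open>In the following, \<open>L\<close> is the finite measure on the parameter space and \<open>s\<close> is the
  family of score functions. All integrals are real-valued Bochner integrals; under the hypotheses
  imposed below on \<open>L\<close>, \<open>s\<close>, \<open>P\<close>, \<open>Q\<close> every integrand is integrable, and the set over which
  \<open>W_score\<close> takes its infimum is nonempty and bounded below by 0.\<close>

definition S_score :: "'t measure \<Rightarrow> ('t \<Rightarrow> 'a \<Rightarrow> real) \<Rightarrow> 'a \<Rightarrow> real" where
  "S_score L s x = (LINT \<theta>|L. s \<theta> x)"

definition d_score :: "'t measure \<Rightarrow> ('t \<Rightarrow> 'a \<Rightarrow> real) \<Rightarrow> 'a \<Rightarrow> 'a \<Rightarrow> real" where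
  "d_score L s x y = (LINT \<theta>|L. \<bar>s \<theta> x - s \<theta> y\<bar>)"

definition W_score ::
    "'t measure \<Rightarrow> ('t \<Rightarrow> 'a \<Rightarrow> real) \<Rightarrow> 'a set \<Rightarrow> 'a measure \<Rightarrow> 'a measure \<Rightarrow> real" where
  "W_score L s D P Q =
     (INF \<kappa>\<in>couplings P Q. LINT z:D \<times> D|\<kappa>. d_score L s (fst z) (snd z))"

definition Delta_score ::
    "'t measure \<Rightarrow> ('t \<Rightarrow> 'a \<Rightarrow> real) \<Rightarrow> 'a set \<Rightarrow> 'a measure \<Rightarrow> 'a measure \<Rightarrow> real" where
  "Delta_score L s D P Q = (LINT x:D|Q. S_score L s x) - (LINT x:D|P. S_score L s x)"

definition CSD ::
    "'t measure \<Rightarrow> ('t \<Rightarrow> 'a \<Rightarrow> real) \<Rightarrow> 'a set \<Rightarrow> real \<Rightarrow> 'a measure \<Rightarrow> 'a measure \<Rightarrow> bool" where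
  "CSD L s D \<gamma> P Q \<longleftrightarrow> (\<exists>\<kappa>\<in>couplings P Q.
     (LINT z:D \<times> D|\<kappa>. (LINT \<theta>|L. max (s \<theta> (fst z) - s \<theta> (snd z)) 0))
     \<le> \<gamma> * (LINT z:D \<times> D|\<kappa>. (LINT \<theta>|L. max (s \<theta> (snd z) - s \<theta> (fst z)) 0)))"

text \<open>The infimum is taken in \<open>ereal\<close>, where \<open>Inf {} = \<infinity>\<close>.\<close>

definition gamma_star ::
    "'t measure \<Rightarrow> ('t \<Rightarrow> 'a \<Rightarrow> real) \<Rightarrow> 'a set \<Rightarrow> 'a measure \<Rightarrow> 'a measure \<Rightarrow> ereal" where
  "gamma_star L s D P Q = Inf (ereal ` {\<gamma>\<in>{0..1}. CSD L s D \<gamma> P Q})"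

text \<open>The last two conditions below are stated with \<open>nn_integral\<close>: a Bochner integral of a
  non-integrable function is 0 and would satisfy the Lipschitz bound vacuously. The order on
  \<open>real ^ 'n\<close> in \<open>mono\<close> is the coordinatewise one.\<close>

definition score_family :: "'t measure \<Rightarrow> ('t \<Rightarrow> real ^ 'n \<Rightarrow> real) \<Rightarrow> bool" where
  "score_family L s \<longleftrightarrow>
     finite_measure L \<and>
     (\<lambda>(\<theta>, x). s \<theta> x) \<in> borel_measurable (L \<Otimes>\<^sub>M borel) \<and>
     (\<forall>\<theta>\<in>space L. mono (s \<theta>)) \<and>
     (\<integral>\<^sup>+\<theta>. ennreal \<bar>s \<theta> 0\<bar> \<partial>L) < \<infinity> \<and>
     (\<exists>C::real. \<forall>x y. (\<integral>\<^sup>+\<theta>. ennreal \<bar>s \<theta> x - s \<theta> y\<bar> \<partial>L) \<le> ennreal (C * l1_norm (x - y)))"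

definition prob_on :: "(real ^ 'n) set \<Rightarrow> (real ^ 'n) measure \<Rightarrow> bool" where
  "prob_on D P \<longleftrightarrow>
     prob_space P \<and> sets P = sets borel \<and> measure P D = 1 \<and> (\<integral>\<^sup>+x. ennreal (l1_norm x) \<partial>P) < \<infinity>"

end

theory Submission
  imports Defs
begin

text \<open>
  For a coupling \<open>\<kappa>\<close> with \<open>d_score\<close>-cost \<open>c\<close>, the identities \<open>t\<^sub>+ + (-t)\<^sub>+ = \<bar>t\<bar>\<close> and
  \<open>t\<^sub>+ - (-t)\<^sub>+ = t\<close> show that its violation and compensation are \<open>(c - \<Delta>) / 2\<close> and
  \<open>(c + \<Delta>) / 2\<close>. Hence dominance at level \<open>\<gamma>\<close> means \<open>c - \<Delta> \<le> \<gamma> (c + \<Delta>)\<close> for some coupling, and as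
  \<open>(c - \<Delta>) / (c + \<Delta>)\<close> is continuous and increasing in \<open>c\<close> when \<open>\<Delta> \<ge> 0\<close>, the infimum over
  couplings is its value at \<open>c = W\<close>. Only for \<open>W = 0\<close> must an optimal coupling exist. It is obtained by
  compactness: a minimizing sequence of couplings clusters, by Tychonoff's theorem, at a finitely
  additive set function whose restriction to rectangles is countably additive because its marginals
  are inner regular.
\<close>

section \<open>Measures from inner regular contents\<close>

text \<open>Tychonoff's theorem makes the cube of \<open>[a, b]\<close>-valued functions compact.
  For an uncountable index type a cluster point need not be the limit of any subsequence, so
  convergence is stated along a filter finer than \<open>sequentially\<close>.\<close>

lemma bounded_functions_cluster_point:
  fixes f :: "nat \<Rightarrow> 'i \<Rightarrow> real"
  assumes "\<And>n i. a \<le> f n i" and "\<And>n i. f n i \<le> b"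
  obtains F m where "F \<noteq> bot" "F \<le> sequentially" "\<And>i. ((\<lambda>n. f n i) \<longlongrightarrow> m i) F"
proof -
  let ?K = "PiE UNIV (\<lambda>_. {a..b}) :: ('i \<Rightarrow> real) set"
  have "compactin (product_topology (\<lambda>_. euclidean) UNIV) ?K"
    by (simp add: compactin_PiE)
  then have "compact ?K"
    by (simp add: euclidean_product_topology)
  moreover have "eventually (\<lambda>x. x \<in> ?K) (filtermap f sequentially)"
    using assms by (simp add: eventually_filtermap PiE_def)
  ultimately obtain m where m: "inf (nhds m) (filtermap f sequentially) \<noteq> bot"
    unfolding compact_filter
    by (metis filtermap_bot_iff sequentially_bot)
  \<comment> \<open>The tails of the sequence are intersected with the pulled-back neighbourhoods of
    \<open>m\<close>. This filter is proper because \<open>m\<close> is a cluster point, and along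
    it \<open>f\<close> tends to \<open>m\<close> by construction.\<close>
  let ?F = "inf sequentially (filtercomap f (nhds m))"
  have "?F \<noteq> bot"
  proof
    assume "?F = bot"
    then have "eventually (\<lambda>_. False) ?F"
      by simp
    then obtain R S where R: "eventually R sequentially" and "eventually S (filtercomap f (nhds m))"
      and RS: "\<And>n. R n \<and> S n \<Longrightarrow> False"
      unfolding eventually_inf by blast
    then obtain T where T: "eventually T (nhds m)" and TS: "\<And>n. T (f n) \<Longrightarrow> S n"
      unfolding eventually_filtercomap by blast
    have "eventually (\<lambda>y. \<not> T y) (filtermap f sequentially)"
      unfolding eventually_filtermap using R by eventually_elim (use RS TS in blast)
    with T have "eventually (\<lambda>_. False) (inf (nhds m) (filtermap f sequentially))"
      unfolding eventually_inf by blast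
    with m show False
      by (simp add: trivial_limit_def)
  qed
  moreover have "((\<lambda>n. f n i) \<longlongrightarrow> m i) ?F" for i
  proof -
    have lim: "filterlim f (nhds m) ?F"
      by (rule filterlim_mono[OF filterlim_filtercomap order_refl inf.cobounded2])
    show ?thesis
    proof (rule topological_tendstoI)
      fix S :: "real set" assume S: "open S" "m i \<in> S"
      have "open ((\<lambda>g::'i \<Rightarrow> real. g i) -` S)"
        using S(1) continuous_on_product_coordinates[of i] by (simp add: open_vimage)
      then have "eventually (\<lambda>g. g i \<in> S) (nhds m)"
        unfolding eventually_nhds using S(2) by (intro exI[of _ "(\<lambda>g. g i) -` S"]) simp
      then show "eventually (\<lambda>n. f n i \<in> S) ?F"
        using lim by (rule eventually_compose_filterlim)
    qed
  qed
  ultimately show ?thesis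
    using that by (meson inf.cobounded1)
qed

text \<open>The condition bounds the remainder \<open>m (E - K)\<close>, so that subadditivity alone
  carries it over to finite unions and intersections. It concerns a single set, since a limit
  content may be regular on some Borel sets and not on others.\<close>

definition inner_regular_on :: "('a::topological_space set \<Rightarrow> real) \<Rightarrow> 'a set \<Rightarrow> bool" where
  "inner_regular_on m E \<longleftrightarrow>
     E \<in> sets borel \<and> (\<forall>e>0. \<exists>K. compact K \<and> K \<subseteq> E \<and> m (E - K) \<le> e)"

text \<open>Only finite additivity is assumed, but on all Borel sets: every \<open>E - K\<close>
  with \<open>E\<close> Borel and \<open>K\<close> compact then has a value, as compact sets are
  closed in a \<open>t2_space\<close>.\<close>

locale borel_content =
  fixes m :: "'a::t2_space set \<Rightarrow> real"
  assumes nonneg: "\<And>A. A \<in> sets borel \<Longrightarrow> 0 \<le> m A"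
    and add: "\<And>A B. A \<in> sets borel \<Longrightarrow> B \<in> sets borel \<Longrightarrow> A \<inter> B = {} \<Longrightarrow> m (A \<union> B) = m A + m B"
begin

lemma empty: "m {} = 0"
  using add[of "{}" "{}"] by simp

lemma mono: 
  assumes "A \<in> sets borel" "B \<in> sets borel" "A \<subseteq> B"
  shows "m A \<le> m B"
proof -
  have "m (A \<union> (B - A)) = m A + m (B - A)"
    using assms by (intro add) auto
  moreover have "A \<union> (B - A) = B"
    using assms by auto
  ultimately show ?thesis
    using nonneg[of "B - A"] assms by auto
qed

lemma subadditive:
  assumes "A \<in> sets borel" "B \<in> sets borel"
  shows "m (A \<union> B) \<le> m A + m B"
proof -
  have "m (A \<union> (B - A)) = m A + m (B - A)"
    using assms by (intro add) auto
  moreover have "m (B - A) \<le> m B"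
    using assms by (intro mono) auto
  ultimately show ?thesis
    by (simp add: Un_Diff_cancel)
qed

lemma finite_subadditive:
  assumes "\<And>i::nat. A i \<in> sets borel"
  shows "m (\<Union>i\<le>n. A i) \<le> (\<Sum>i\<le>n. m (A i))"
proof (induction n)
  case (Suc n)
  have "m (A (Suc n) \<union> (\<Union>i\<le>n. A i)) \<le> m (A (Suc n)) + m (\<Union>i\<le>n. A i)"
    using assms by (intro subadditive) auto
  with Suc show ?case
    by (simp add: atMost_Suc)
qed simp

lemma inner_regular_on_empty: "inner_regular_on m {}"
  unfolding inner_regular_on_def using empty by (auto intro!: exI[of _ "{}"])

lemma inner_regular_on_Un:
  assumes "inner_regular_on m A" "inner_regular_on m B"
  shows "inner_regular_on m (A \<union> B)"
  unfolding inner_regular_on_def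
proof (intro conjI allI impI)
  show AB: "A \<union> B \<in> sets borel"
    using assms by (auto simp: inner_regular_on_def)
  fix e :: real assume "e > 0"
  then obtain K L where K: "compact K" "K \<subseteq> A" "m (A - K) \<le> e / 2"
    and L: "compact L" "L \<subseteq> B" "m (B - L) \<le> e / 2"
    using assms unfolding inner_regular_on_def by (meson half_gt_zero)
  have [measurable]: "A \<in> sets borel" "B \<in> sets borel" "K \<in> sets borel" "L \<in> sets borel"
    using assms K L by (auto simp: inner_regular_on_def compact_imp_closed)
  have "m ((A \<union> B) - (K \<union> L)) \<le> m ((A - K) \<union> (B - L))"
    by (rule mono) auto
  also have "\<dots> \<le> m (A - K) + m (B - L)"
    by (rule subadditive) auto
  finally have "m ((A \<union> B) - (K \<union> L)) \<le> e"
    using K L by simp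
  with K L show "\<exists>K. compact K \<and> K \<subseteq> A \<union> B \<and> m (A \<union> B - K) \<le> e"
    by (intro exI[of _ "K \<union> L"]) auto
qed

lemma inner_regular_on_Int:
  assumes "inner_regular_on m A" "inner_regular_on m B"
  shows "inner_regular_on m (A \<inter> B)"
  unfolding inner_regular_on_def
proof (intro conjI allI impI)
  show AB: "A \<inter> B \<in> sets borel"
    using assms by (auto simp: inner_regular_on_def)
  fix e :: real assume "e > 0"
  then obtain K L where K: "compact K" "K \<subseteq> A" "m (A - K) \<le> e / 2"
    and L: "compact L" "L \<subseteq> B" "m (B - L) \<le> e / 2"
    using assms unfolding inner_regular_on_def by (meson half_gt_zero)
  have [measurable]: "A \<in> sets borel" "B \<in> sets borel" "K \<in> sets borel" "L \<in> sets borel"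
    using assms K L by (auto simp: inner_regular_on_def compact_imp_closed)
  have "m ((A \<inter> B) - (K \<inter> L)) \<le> m ((A - K) \<union> (B - L))"
    by (rule mono) auto
  also have "\<dots> \<le> m (A - K) + m (B - L)"
    by (rule subadditive) auto
  finally have "m ((A \<inter> B) - (K \<inter> L)) \<le> e"
    using K L by simp
  with K L show "\<exists>K. compact K \<and> K \<subseteq> A \<inter> B \<and> m (A \<inter> B - K) \<le> e"
    by (intro exI[of _ "K \<inter> L"]) (auto intro: compact_Int)
qed

text \<open>Closure under complements is built in. Unions are covered by the two preceding lemmas,
  because the complement of a union is an intersection of complements.\<close>

definition regular_sets :: "'a set set" where
  "regular_sets = {E. inner_regular_on m E \<and> inner_regular_on m (- E)}"

lemma algebra_regular_sets:
  assumes "inner_regular_on m UNIV"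
  shows "algebra UNIV regular_sets"
  unfolding algebra_iff_Un regular_sets_def
  using assms inner_regular_on_empty inner_regular_on_Un inner_regular_on_Int
  by (auto simp: Compl_eq_Diff_UNIV[symmetric])

text \<open>Compactness replaces countable additivity: if compact \<open>K i \<subseteq> A i\<close> fill up \<open>A i\<close> up to
  mass \<open>e / 2 ^ Suc i\<close>, then finitely many of the \<open>K i\<close> already have empty intersection.\<close>
lemma regular_decseq_tendsto_0:
  assumes A: "\<And>i::nat. inner_regular_on m (A i)" and dec: "decseq A" and "(\<Inter>i. A i) = {}"
  shows "(\<lambda>i. m (A i)) \<longlonglongrightarrow> 0"
proof (rule decreasing_tendsto)
  have Ab: "A i \<in> sets borel" for i
    using A by (auto simp: inner_regular_on_def)
  then show "\<forall>\<^sub>F n in sequentially. 0 \<le> m (A n)"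
    using nonneg by simp
  fix e :: real assume "0 < e"
  define d where "d i = e / 2 * (1 / 2) ^ Suc i" for i
  have "\<exists>K. compact K \<and> K \<subseteq> A i \<and> m (A i - K) \<le> d i" for i
  proof -
    have "0 < d i"
      using \<open>0 < e\<close> by (simp add: d_def)
    with A[of i] show ?thesis
      by (simp add: inner_regular_on_def)
  qed
  then obtain K where K: "\<And>i. compact (K i)" "\<And>i. K i \<subseteq> A i" "\<And>i. m (A i - K i) \<le> d i"
    by metis
  have Kb: "K i \<in> sets borel" for i
    using K by (simp add: compact_imp_closed)
  have "\<exists>I. finite I \<and> K 0 \<inter> (\<Inter>i\<in>I. K i) = {}"
  proof (rule ccontr)
    assume "\<not> ?thesis"
    then have "K 0 \<inter> (\<Inter>i\<in>UNIV. K i) \<noteq> {}"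
      using compact_imp_fip_image[of "K 0" UNIV K] K by (metis compact_imp_closed)
    moreover have "(\<Inter>i. K i) \<subseteq> (\<Inter>i. A i)"
      using K(2) by (rule INF_mono')
    ultimately show False
      using assms(3) by simp
  qed
  then obtain I where I: "finite I" "K 0 \<inter> (\<Inter>i\<in>I. K i) = {}"
    by blast
  \<comment> \<open>\<open>K 0\<close> is the ambient compact set of the finite intersection
    argument, so index 0 counts along with \<open>I\<close>; it also keeps the set nonempty, as
    \<open>Max\<close> requires.\<close>
  define n where "n = Max (insert 0 I)"
  have sub: "A n \<subseteq> (\<Union>i\<le>n. A i - K i)"
  proof
    fix x assume x: "x \<in> A n"
    obtain i where i: "i \<in> insert 0 I" "x \<notin> K i"
      using I(2) by auto
    then have "i \<le> n"
      unfolding n_def using I(1) by (intro Max_ge) auto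
    moreover have "x \<in> A i"
      using decseqD[OF dec \<open>i \<le> n\<close>] x by auto
    ultimately show "x \<in> (\<Union>i\<le>n. A i - K i)"
      using i by auto
  qed
  have "m (A n) \<le> m (\<Union>i\<le>n. A i - K i)"
    using Ab Kb by (intro mono sub sets.finite_UN) auto
  also have "\<dots> \<le> (\<Sum>i\<le>n. m (A i - K i))"
    using Ab Kb by (intro finite_subadditive) auto
  also have "\<dots> \<le> (\<Sum>i\<le>n. d i)"
    using K by (intro sum_mono)
  also have "\<dots> = e / 2 * (1 - (1 / 2) ^ Suc n)"
    unfolding d_def sum_distrib_left[symmetric]
    by (induction n) (simp_all add: field_simps)
  also have "\<dots> \<le> e / 2 * 1"
    using \<open>0 < e\<close> by (intro mult_left_mono) auto
  also have "\<dots> < e"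
    using \<open>0 < e\<close> by simp
  finally have n: "m (A n) < e" .
  have "m (A k) < e" if "n \<le> k" for k
    using mono[OF Ab Ab, of k n] dec that n by (auto simp: decseq_def)
  then show "\<forall>\<^sub>F n in sequentially. m (A n) < e"
    using eventually_at_top_linorder by blast
qed

text \<open>Caratheodory's theorem in the form for finite contents continuous at the empty set,
  where \<open>regular_decseq_tendsto_0\<close> supplies the continuity. Agreement is claimed on
  \<open>regular_sets\<close> only: on other Borel sets \<open>m\<close> may differ from the
  extension.\<close>

lemma measure_extension:
  assumes U: "inner_regular_on m UNIV" and gen: "sigma_sets UNIV regular_sets = sets borel"
  obtains \<mu> where "sets \<mu> = sets borel" "\<And>E. E \<in> regular_sets \<Longrightarrow> emeasure \<mu> E = ennreal (m E)"
proof -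
  interpret algebra UNIV regular_sets
    using U by (rule algebra_regular_sets)
  have reg: "E \<in> sets borel" if "E \<in> regular_sets" for E
    using that by (simp add: regular_sets_def inner_regular_on_def)
  have "\<exists>\<mu>. (\<forall>E\<in>regular_sets. \<mu> E = ennreal (m E)) \<and>
      measure_space UNIV (sigma_sets UNIV regular_sets) \<mu>"
  proof (rule caratheodory_empty_continuous)
    show "positive regular_sets (\<lambda>E. ennreal (m E))"
      by (simp add: positive_def empty)
    show "additive regular_sets (\<lambda>E. ennreal (m E))"
      using reg by (auto simp: additive_def add nonneg)
    fix A :: "nat \<Rightarrow> 'a set"
    assume "range A \<subseteq> regular_sets" "decseq A" "(\<Inter>i. A i) = {}"
    then have "(\<lambda>i. m (A i)) \<longlonglongrightarrow> 0"
      by (intro regular_decseq_tendsto_0) (auto simp: regular_sets_def)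
    then show "(\<lambda>i. ennreal (m (A i))) \<longlonglongrightarrow> 0"
      using tendsto_ennrealI by fastforce
  qed simp
  then obtain \<mu> where \<mu>: "\<And>E. E \<in> regular_sets \<Longrightarrow> \<mu> E = ennreal (m E)"
    "measure_space UNIV (sets borel) \<mu>"
    unfolding gen by blast
  define \<nu> where "\<nu> = measure_of UNIV (sets borel) \<mu>"
  have "sets \<nu> = sets borel"
    by (simp add: \<nu>_def sets.sigma_sets_eq[of borel, simplified])
  moreover have "emeasure \<nu> E = ennreal (m E)" if "E \<in> regular_sets" for E
    using emeasure_measure_of[OF \<nu>_def] reg[OF that] \<mu> that \<open>sets \<nu> = sets borel\<close>
    by (auto simp: measure_space_def)
  ultimately show ?thesis
    using that by blast
qed

end

section \<open>Cluster points of couplings\<close>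

text \<open>Inner regularity of finite Borel measures on Polish spaces, put into the remainder form
  of \<open>inner_regular_on\<close>.\<close>

lemma measure_inner_approx:
  fixes P :: "'a::{complete_space, second_countable_topology} measure"
  assumes "finite_measure P" and sets: "sets P = sets borel" and A: "A \<in> sets borel" and "e > 0"
  obtains K where "compact K" "K \<subseteq> A" "measure P (A - K) \<le> e"
proof -
  interpret finite_measure P by fact
  have "\<exists>K\<in>{K. K \<subseteq> A \<and> compact K}. emeasure P A < emeasure P K + ennreal e"
    by (rule SUP_approx_ennreal[OF \<open>e > 0\<close> _ inner_regular[OF sets _ A]]) auto
  then obtain K where K: "K \<subseteq> A" "compact K" "emeasure P A < emeasure P K + ennreal e"
    by blast
  have "measure P (A - K) = measure P A - measure P K"
    using K A sets by (intro finite_measure_Diff) (auto simp: compact_imp_closed)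
  moreover have "measure P A < measure P K + e"
    using K(3) \<open>e > 0\<close> by (simp add: emeasure_eq_measure ennreal_less_iff flip: ennreal_plus)
  ultimately show ?thesis
    using that[of K] K by simp
qed

lemma coupling_measure_fst:
  assumes "\<kappa> \<in> couplings P Q" "A \<in> sets P" "space Q = UNIV"
  shows "measure \<kappa> (A \<times> UNIV) = measure P A"
proof -
  have \<kappa>: "distr \<kappa> P fst = P" "sets \<kappa> = sets (P \<Otimes>\<^sub>M Q)"
    using assms by (auto simp: couplings_def)
  have "measure (distr \<kappa> P fst) A = measure \<kappa> (fst -` A \<inter> space \<kappa>)"
    using assms \<kappa> by (intro measure_distr) (auto cong: measurable_cong_sets)
  also have "fst -` A \<inter> space \<kappa> = A \<times> UNIV"
    using sets_eq_imp_space_eq[OF \<kappa>(2)] sets.sets_into_space[OF assms(2)] assms(3)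
    by (auto simp: space_pair_measure)
  finally show ?thesis
    using \<kappa> by simp
qed

lemma coupling_measure_snd:
  assumes "\<kappa> \<in> couplings P Q" "B \<in> sets Q" "space P = UNIV"
  shows "measure \<kappa> (UNIV \<times> B) = measure Q B"
proof -
  have \<kappa>: "distr \<kappa> Q snd = Q" "sets \<kappa> = sets (P \<Otimes>\<^sub>M Q)"
    using assms by (auto simp: couplings_def)
  have "measure (distr \<kappa> Q snd) B = measure \<kappa> (snd -` B \<inter> space \<kappa>)"
    using assms \<kappa> by (intro measure_distr) (auto cong: measurable_cong_sets)
  also have "snd -` B \<inter> space \<kappa> = UNIV \<times> B"
    using sets_eq_imp_space_eq[OF \<kappa>(2)] sets.sets_into_space[OF assms(2)] assms(3)
    by (auto simp: space_pair_measure)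
  finally show ?thesis
    using \<kappa> by simp
qed

lemma sets_pair_borel:
  fixes P :: "'a::second_countable_topology measure" and Q :: "'b::second_countable_topology measure"
  assumes "sets P = sets borel" "sets Q = sets borel"
  shows "sets (P \<Otimes>\<^sub>M Q) = sets borel"
  using sets_pair_measure_cong[OF assms] unfolding borel_prod .

text \<open>The limit on all Borel sets is only finitely additive, but its marginals are the tight
  measures \<open>P\<close> and \<open>Q\<close>, so it is inner regular on rectangles and extends from there.\<close>
lemma couplings_cluster_point:
  fixes P :: "'a::{complete_space, second_countable_topology} measure"
    and Q :: "'b::{complete_space, second_countable_topology} measure"
  assumes P: "prob_space P" "sets P = sets borel" and Q: "prob_space Q" "sets Q = sets borel"
    and \<kappa>: "\<And>n::nat. \<kappa> n \<in> couplings P Q"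
  obtains \<mu> where "\<mu> \<in> couplings P Q"
    "\<And>U c. open U \<Longrightarrow> (\<lambda>n. measure (\<kappa> n) U) \<longlonglongrightarrow> c \<Longrightarrow> measure \<mu> U \<le> c"
proof -
  interpret P: prob_space P by fact
  interpret Q: prob_space Q by fact
  have spP: "space P = UNIV" and spQ: "space Q = UNIV"
    using P Q by (auto dest: sets_eq_imp_space_eq)
  have sets_PQ: "sets (P \<Otimes>\<^sub>M Q) = sets borel"
    using P Q by (intro sets_pair_borel)
  have prob: "prob_space (\<kappa> n)" and sets: "sets (\<kappa> n) = sets borel" for n
    using \<kappa>[of n] sets_PQ by (auto simp: couplings_def)
  obtain F m where F: "F \<noteq> bot" "F \<le> sequentially"
    and lim: "\<And>E. ((\<lambda>n. measure (\<kappa> n) E) \<longlongrightarrow> m E) F"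
    by (rule bounded_functions_cluster_point[of 0 "\<lambda>n. measure (\<kappa> n)" 1])
      (auto intro: prob_space.prob_le_1[OF prob])
  interpret borel_content m
  proof
    show "0 \<le> m A" for A
      using F(1) by (intro tendsto_lowerbound[OF lim]) auto
    fix A B :: "('a \<times> 'b) set" assume AB: "A \<in> sets borel" "B \<in> sets borel" "A \<inter> B = {}"
    have "measure (\<kappa> n) (A \<union> B) = measure (\<kappa> n) A + measure (\<kappa> n) B" for n
      using AB sets prob_space.finite_measure[OF prob] by (intro finite_measure.finite_measure_Union) auto
    then show "m (A \<union> B) = m A + m B"
      using tendsto_unique[OF F(1) lim[of "A \<union> B"]] tendsto_add[OF lim[of A] lim[of B]] by simp
  qed
  \<comment> \<open>The marginals of \<open>\<kappa> n\<close> do not depend on \<open>n\<close>, so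
    the limits are taken over constant sequences.\<close>
  have m_fst: "m (A \<times> UNIV) = measure P A" if "A \<in> sets borel" for A
    using tendsto_unique[OF F(1) lim[of "A \<times> UNIV"], of "measure P A"]
      coupling_measure_fst[OF \<kappa>] that P spQ by simp
  have m_snd: "m (UNIV \<times> B) = measure Q B" if "B \<in> sets borel" for B
    using tendsto_unique[OF F(1) lim[of "UNIV \<times> B"], of "measure Q B"]
      coupling_measure_snd[OF \<kappa>] that Q spP by simp
  have times_borel: "A \<times> B \<in> sets borel" if "A \<in> sets borel" "B \<in> sets borel" for A :: "'a set" and B :: "'b set"
    using that by (metis borel_prod pair_measureI)
  have inner_times: "inner_regular_on m (A \<times> B)" if AB: "A \<in> sets borel" "B \<in> sets borel" for A B
    unfolding inner_regular_on_def
  proof (intro conjI allI impI times_borel AB)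
    fix e :: real assume "e > 0"
    then have "e / 2 > 0"
      by simp
    obtain K where K: "compact K" "K \<subseteq> A" "measure P (A - K) \<le> e / 2"
      using measure_inner_approx[OF P.finite_measure P(2) AB(1) \<open>e / 2 > 0\<close>] .
    obtain L where L: "compact L" "L \<subseteq> B" "measure Q (B - L) \<le> e / 2"
      using measure_inner_approx[OF Q.finite_measure Q(2) AB(2) \<open>e / 2 > 0\<close>] .
    have [simp]: "K \<in> sets borel" "L \<in> sets borel"
      using K L by (auto simp: compact_imp_closed)
    \<comment> \<open>A point outside \<open>K \<times> L\<close> has its first coordinate outside
      \<open>K\<close> or its second outside \<open>L\<close>; both events are controlled by a
      marginal.\<close>
    have "m (A \<times> B - K \<times> L) \<le> m ((A - K) \<times> UNIV \<union> UNIV \<times> (B - L))"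
      using AB by (intro mono sets.Un sets.Diff times_borel) auto
    also have "\<dots> \<le> m ((A - K) \<times> UNIV) + m (UNIV \<times> (B - L))"
      using AB by (intro subadditive times_borel sets.Diff) auto
    also have "\<dots> \<le> e"
      using K L AB m_fst[OF sets.Diff] m_snd[OF sets.Diff] by (simp add: field_simps)
    finally show "\<exists>K. compact K \<and> K \<subseteq> A \<times> B \<and> m (A \<times> B - K) \<le> e"
      using K L by (intro exI[of _ "K \<times> L"]) (auto intro: compact_Times)
  qed
  have inner_UNIV: "inner_regular_on m UNIV"
    using inner_times[of UNIV UNIV] by simp
  have times_regular: "A \<times> B \<in> regular_sets" if "A \<in> sets borel" "B \<in> sets borel" for A B
  proof -
    have "- (A \<times> B) = (- A) \<times> UNIV \<union> UNIV \<times> (- B)"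
      by auto
    then show ?thesis
      unfolding regular_sets_def using that
      by (auto intro!: inner_times inner_regular_on_Un)
  qed
  have gen: "sigma_sets UNIV regular_sets = sets borel"
  proof
    show "sigma_sets UNIV regular_sets \<subseteq> sets borel"
      using sets.sigma_sets_subset[of regular_sets borel]
      by (auto simp: regular_sets_def inner_regular_on_def)
    have "sets (borel :: ('a \<times> 'b) measure) = sets (borel \<Otimes>\<^sub>M borel)"
      unfolding borel_prod ..
    also have "\<dots> = sigma_sets UNIV {a \<times> b |a b. a \<in> sets borel \<and> b \<in> sets borel}"
      by (simp add: sets_pair_measure)
    also have "\<dots> \<subseteq> sigma_sets UNIV regular_sets"
      using times_regular by (intro sigma_sets_mono') auto
    finally show "sets borel \<subseteq> sigma_sets UNIV regular_sets" .
  qed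
  obtain \<mu> where sets_\<mu>: "sets \<mu> = sets borel"
    and \<mu>: "\<And>E. E \<in> regular_sets \<Longrightarrow> emeasure \<mu> E = ennreal (m E)"
    using measure_extension[OF inner_UNIV gen] by blast
  have sp\<mu>: "space \<mu> = UNIV"
    using sets_eq_imp_space_eq[OF sets_\<mu>] by simp
  have sets_\<mu>': "sets \<mu> = sets (P \<Otimes>\<^sub>M Q)"
    using sets_\<mu> sets_PQ by simp
  have \<mu>_fst: "distr \<mu> P fst = P"
  proof (rule measure_eqI)
    fix A assume "A \<in> sets (distr \<mu> P fst)"
    then have A: "A \<in> sets P"
      by simp
    have "emeasure (distr \<mu> P fst) A = emeasure \<mu> (A \<times> UNIV)"
      using A sets_\<mu>' by (subst emeasure_distr) (auto simp: sp\<mu> vimage_fst cong: measurable_cong_sets)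
    then show "emeasure (distr \<mu> P fst) A = emeasure P A"
      using A P by (simp add: \<mu> times_regular m_fst P.emeasure_eq_measure)
  qed simp
  have \<mu>_snd: "distr \<mu> Q snd = Q"
  proof (rule measure_eqI)
    fix A assume "A \<in> sets (distr \<mu> Q snd)"
    then have A: "A \<in> sets Q"
      by simp
    have "emeasure (distr \<mu> Q snd) A = emeasure \<mu> (UNIV \<times> A)"
      using A sets_\<mu>' by (subst emeasure_distr) (auto simp: sp\<mu> vimage_snd cong: measurable_cong_sets)
    then show "emeasure (distr \<mu> Q snd) A = emeasure Q A"
      using A Q by (simp add: \<mu> times_regular m_snd Q.emeasure_eq_measure)
  qed simp
  \<comment> \<open>The whole space is kept in the form of a rectangle, so that \<open>m_fst\<close>
    computes its mass as that of \<open>P\<close>.\<close>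
  have "emeasure \<mu> (UNIV \<times> UNIV) = 1"
    using P.prob_space spP by (simp add: \<mu> times_regular m_fst del: UNIV_Times_UNIV)
  then interpret \<mu>: prob_space \<mu>
    by (intro prob_spaceI) (simp add: sp\<mu>)
  have "\<mu> \<in> couplings P Q"
    using sets_\<mu>' \<mu>_fst \<mu>_snd \<mu>.prob_space_axioms by (simp add: couplings_def)
  moreover have "measure \<mu> U \<le> c" if U: "open U" and c: "(\<lambda>n. measure (\<kappa> n) U) \<longlonglongrightarrow> c" for U c
  proof -
    have "m U = c"
      using tendsto_unique[OF F(1) lim] tendsto_mono[OF F(2) c] by blast
    \<comment> \<open>\<open>U\<close> need not lie in \<open>regular_sets\<close>, so
      \<open>\<mu>\<close> and \<open>m\<close> cannot be compared on it directly. Each compact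
      subset of \<open>U\<close> is covered by finitely many open rectangles inside
      \<open>U\<close>; their union is regular, and there \<open>\<mu>\<close> equals
      \<open>m\<close>.\<close>
    have "emeasure \<mu> U = (SUP K\<in>{K. K \<subseteq> U \<and> compact K}. emeasure \<mu> K)"
      using U sets_\<mu> by (intro inner_regular) auto
    also have "\<dots> \<le> ennreal c"
    proof (rule SUP_least)
      fix K assume "K \<in> {K. K \<subseteq> U \<and> compact K}"
      then have K: "compact K" "K \<subseteq> U"
        by auto
      let ?C = "{A \<times> B |A B. open A \<and> open B \<and> A \<times> B \<subseteq> U}"
      have "K \<subseteq> \<Union>?C"
      proof
        fix z assume "z \<in> K"
        with K have "z \<in> U"
          by auto
        from open_prod_elim[OF U this] obtain A B where "open A" "open B" "z \<in> A \<times> B" "A \<times> B \<subseteq> U"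
          by blast
        then show "z \<in> \<Union>?C"
          by blast
      qed
      moreover have "open T" if "T \<in> ?C" for T
        using that by (auto intro: open_Times)
      ultimately obtain R where R: "R \<subseteq> ?C" "finite R" "K \<subseteq> \<Union>R"
        by (rule compactE[OF K(1), of ?C]) auto
      interpret reg: algebra UNIV regular_sets
        using inner_UNIV by (rule algebra_regular_sets)
      have UR: "\<Union>R \<in> regular_sets"
        using R by (intro reg.finite_Union) (auto intro!: times_regular)
      then have URb: "\<Union>R \<in> sets borel"
        by (simp add: regular_sets_def inner_regular_on_def)
      have "emeasure \<mu> K \<le> emeasure \<mu> (\<Union>R)"
        using R URb sets_\<mu> by (intro emeasure_mono) auto
      also have "\<dots> = ennreal (m (\<Union>R))"
        using UR by (rule \<mu>)
      also have "\<dots> \<le> ennreal (m U)"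
        using R URb U by (intro ennreal_leI mono) auto
      finally show "emeasure \<mu> K \<le> ennreal c"
        using \<open>m U = c\<close> by simp
    qed
    finally show "measure \<mu> U \<le> c"
      using nonneg[of U] \<open>m U = c\<close> U by (simp add: \<mu>.emeasure_eq_measure ennreal_le_iff)
  qed
  ultimately show ?thesis
    using that by blast
qed

section \<open>Transport costs of score families\<close>

lemma set_integral_eq_integral_AE:
  fixes f :: "'a \<Rightarrow> real"
  assumes "AE x in M. x \<in> A" "A \<in> sets M" "f \<in> borel_measurable M"
  shows "(LINT x:A|M. f x) = (LINT x|M. f x)"
  unfolding set_lebesgue_integral_def using assms
  by (intro integral_cong_AE) auto

lemma continuous_on_l1_norm [continuous_intros]:
  assumes "continuous_on A f"
  shows "continuous_on A (\<lambda>x. l1_norm (f x :: real ^ 'n))"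
  unfolding l1_norm_def using assms by (intro continuous_intros)

lemma l1_norm_nonneg: "0 \<le> l1_norm x"
  by (simp add: l1_norm_def sum_nonneg)

lemma l1_norm_diff: "l1_norm (x - y) \<le> l1_norm x + l1_norm y"
  unfolding l1_norm_def sum.distrib[symmetric] by (intro sum_mono) auto

text \<open>At each point \<open>w\<close> the increment is squeezed by a continuous function of
  \<open>z\<close> vanishing at \<open>w\<close>, which avoids comparing \<open>l1_norm\<close> with
  the Euclidean norm.\<close>

lemma continuous_on_l1_lipschitz:
  fixes f :: "real ^ 'n \<Rightarrow> real ^ 'm \<Rightarrow> real"
  assumes "\<And>x y x' y'. \<bar>f x y - f x' y'\<bar> \<le> C * (l1_norm (x - x') + l1_norm (y - y'))"
  shows "continuous_on UNIV (\<lambda>z. f (fst z) (snd z))"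
  unfolding continuous_on_def
proof
  fix w :: "(real ^ 'n) \<times> (real ^ 'm)"
  have "continuous_on UNIV (\<lambda>z. C * (l1_norm (fst z - fst w) + l1_norm (snd z - snd w)))"
    by (intro continuous_intros)
  then have "((\<lambda>z. C * (l1_norm (fst z - fst w) + l1_norm (snd z - snd w)))
      \<longlongrightarrow> C * (l1_norm (fst w - fst w) + l1_norm (snd w - snd w))) (at w)"
    unfolding continuous_on_def by blast
  then have "((\<lambda>z. C * (l1_norm (fst z - fst w) + l1_norm (snd z - snd w))) \<longlongrightarrow> 0) (at w)"
    by (simp add: l1_norm_def)
  then have "((\<lambda>z. f (fst z) (snd z) - f (fst w) (snd w)) \<longlongrightarrow> 0) (at w)"
    by (rule Lim_null_comparison[rotated]) (use assms in auto)
  then show "((\<lambda>z. f (fst z) (snd z)) \<longlongrightarrow> f (fst w) (snd w)) (at w)"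
    by (rule LIM_zero_cancel)
qed

section \<open>Regularity of the score distance and the mean score\<close>

locale score_couplings =
  fixes L :: "'t measure"
    and s :: "'t \<Rightarrow> real ^ 'n \<Rightarrow> real"
    and D :: "(real ^ 'n) set"
    and P Q :: "(real ^ 'n) measure"
  assumes D: "D \<in> sets borel"
    and score: "score_family L s"
    and P: "prob_on D P" and Q: "prob_on D Q"
begin

abbreviation "S \<equiv> S_score L s"
abbreviation "d \<equiv> d_score L s"
abbreviation "\<Delta> \<equiv> Delta_score L s D P Q"
abbreviation "cost \<kappa> \<equiv> LINT z|\<kappa>. d (fst z) (snd z)"

text \<open>The Lipschitz bound makes differences of scores integrable; adding the integrable score
  at 0 yields every single score.\<close>

lemma integrable_diff: "integrable L (\<lambda>\<theta>. s \<theta> x - s \<theta> y)"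
  and integrable_score: "integrable L (\<lambda>\<theta>. s \<theta> x)"
proof -
  have meas: "(\<lambda>\<theta>. s \<theta> z) \<in> borel_measurable L" for z
  proof -
    have "(\<lambda>(\<theta>, x). s \<theta> x) \<in> borel_measurable (L \<Otimes>\<^sub>M borel)"
      using score by (simp add: score_family_def)
    from measurable_compose[OF measurable_Pair2' this, of z] show ?thesis
      by simp
  qed
  obtain C where C: "\<And>x y. (\<integral>\<^sup>+\<theta>. ennreal \<bar>s \<theta> x - s \<theta> y\<bar> \<partial>L) \<le> ennreal (C * l1_norm (x - y))"
    using score unfolding score_family_def by blast
  show *: "integrable L (\<lambda>\<theta>. s \<theta> x - s \<theta> y)" for x y
    using meas le_less_trans[OF C ennreal_less_top] by (intro integrableI_bounded) auto
  have "integrable L (\<lambda>\<theta>. s \<theta> 0)"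
    using meas score by (intro integrableI_bounded) (auto simp: score_family_def)
  from Bochner_Integration.integrable_add[OF *[of x 0] this] show "integrable L (\<lambda>\<theta>. s \<theta> x)"
    by simp
qed

lemma d_nonneg: "0 \<le> d x y"
  by (simp add: d_score_def)

lemma d_commute: "d x y = d y x"
  by (simp add: d_score_def abs_minus_commute)

lemma positive_part_integral: "(LINT \<theta>|L. max (s \<theta> x - s \<theta> y) 0) = (d x y + (S x - S y)) / 2"
proof -
  have "(LINT \<theta>|L. max (s \<theta> x - s \<theta> y) 0) = (LINT \<theta>|L. (\<bar>s \<theta> x - s \<theta> y\<bar> + (s \<theta> x - s \<theta> y)) / 2)"
    by (intro Bochner_Integration.integral_cong) (auto simp: max_def)
  also have "\<dots> = (d x y + (S x - S y)) / 2"
    unfolding d_score_def S_score_def using integrable_diff integrable_score by simp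
  finally show ?thesis .
qed

lemma d_lipschitz: obtains C where "C \<ge> 0" "\<And>x y. d x y \<le> C * l1_norm (x - y)"
proof -
  obtain C where C: "\<And>x y. (\<integral>\<^sup>+\<theta>. ennreal \<bar>s \<theta> x - s \<theta> y\<bar> \<partial>L) \<le> ennreal (C * l1_norm (x - y))"
    using score unfolding score_family_def by blast
  \<comment> \<open>The constant in \<open>score_family\<close> may have any sign. Its absolute
    value makes the right-hand side nonnegative, as is needed to return from \<open>ennreal\<close>
    to the reals.\<close>
  have "d x y \<le> \<bar>C\<bar> * l1_norm (x - y)" for x y
  proof -
    have "ennreal (d x y) = (\<integral>\<^sup>+\<theta>. ennreal \<bar>s \<theta> x - s \<theta> y\<bar> \<partial>L)"
      unfolding d_score_def using integrable_diff by (intro nn_integral_eq_integral[symmetric]) auto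
    also have "\<dots> \<le> ennreal (C * l1_norm (x - y))"
      by (rule C)
    also have "\<dots> \<le> ennreal (\<bar>C\<bar> * l1_norm (x - y))"
      using l1_norm_nonneg by (intro ennreal_leI mult_right_mono) auto
    finally show ?thesis
      by (subst (asm) ennreal_le_iff) (auto intro: mult_nonneg_nonneg l1_norm_nonneg)
  qed
  then show ?thesis
    using that[of "\<bar>C\<bar>"] by simp
qed

lemma S_diff_le: "\<bar>S x - S y\<bar> \<le> d x y"
  unfolding S_score_def d_score_def using integrable_score
  by (simp add: integral_abs_bound flip: Bochner_Integration.integral_diff)

text \<open>\<open>d\<close> is the L1 distance between the functions
  \<open>\<theta> \<mapsto> s \<theta> x\<close>, hence a pseudometric; two quadrilateral
  inequalities give the bound.\<close>

lemma d_diff_le: "\<bar>d x y - d x' y'\<bar> \<le> d x x' + d y y'"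
proof -
  have tri: "d a b \<le> d a a' + (d a' b' + d b b')" for a b a' b'
  proof -
    have "d a b \<le> (LINT \<theta>|L. \<bar>s \<theta> a - s \<theta> a'\<bar> + (\<bar>s \<theta> a' - s \<theta> b'\<bar> + \<bar>s \<theta> b - s \<theta> b'\<bar>))"
      unfolding d_score_def using integrable_diff by (intro integral_mono) auto
    also have "\<dots> = d a a' + (d a' b' + d b b')"
      unfolding d_score_def using integrable_diff by simp
    finally show ?thesis .
  qed
  show ?thesis
    using tri[of x y x' y'] tri[of x' y' x y] d_commute[of x x'] d_commute[of y y'] by linarith
qed

lemma continuous_d: "continuous_on UNIV (\<lambda>z. d (fst z) (snd z))"
proof -
  obtain C where C: "C \<ge> 0" "\<And>x y. d x y \<le> C * l1_norm (x - y)"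
    using d_lipschitz by blast
  show ?thesis
  proof (rule continuous_on_l1_lipschitz)
    fix x y x' y' :: "real ^ 'n"
    show "\<bar>d x y - d x' y'\<bar> \<le> C * (l1_norm (x - x') + l1_norm (y - y'))"
      using d_diff_le[of x y x' y'] C(2)[of x x'] C(2)[of y y'] by (simp add: distrib_left)
  qed
qed

lemma continuous_S: "continuous_on UNIV S"
proof -
  obtain C where C: "C \<ge> 0" "\<And>x y. d x y \<le> C * l1_norm (x - y)"
    using d_lipschitz by blast
  \<comment> \<open>A dummy second coordinate lets the two-variable criterion apply; composing with
    the diagonal map removes it.\<close>
  have "continuous_on UNIV (\<lambda>z::(real ^ 'n) \<times> (real ^ 'n). S (fst z))"
  proof (rule continuous_on_l1_lipschitz)
    fix x y x' y' :: "real ^ 'n"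
    show "\<bar>S x - S x'\<bar> \<le> C * (l1_norm (x - x') + l1_norm (y - y'))"
      using S_diff_le[of x x'] C(2)[of x x'] mult_nonneg_nonneg[OF C(1) l1_norm_nonneg[of "y - y'"]]
      by (simp add: distrib_left)
  qed
  from continuous_on_compose2[OF this, of UNIV "\<lambda>x. (x, x)"] show ?thesis
    by (simp add: continuous_on_Pair continuous_on_id)
qed

lemma measurable_S [measurable]: "S \<in> borel_measurable borel"
  using continuous_S by (rule borel_measurable_continuous_onI)

lemma measurable_d [measurable]: "(\<lambda>z. d (fst z) (snd z)) \<in> borel_measurable borel"
  using continuous_d by (rule borel_measurable_continuous_onI)

text \<open>\<open>S\<close> grows at most linearly by its Lipschitz bound, so the finite first
  moment dominates it.\<close>

lemma integrable_S:
  assumes R: "prob_on D R"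
  shows "integrable R S" and "integrable R l1_norm"
proof -
  interpret prob_space R
    using R by (simp add: prob_on_def)
  have [measurable_cong]: "sets R = sets borel"
    using R by (simp add: prob_on_def)
  have "l1_norm \<in> borel_measurable (borel :: (real ^ 'n) measure)"
    by (intro borel_measurable_continuous_onI continuous_intros)
  then have [measurable]: "l1_norm \<in> borel_measurable R"
    by measurable
  show l1: "integrable R l1_norm"
    using R by (intro integrableI_bounded) (auto simp: prob_on_def l1_norm_nonneg)
  obtain C where C: "C \<ge> 0" "\<And>x y. d x y \<le> C * l1_norm (x - y)"
    using d_lipschitz by blast
  show "integrable R S"
  proof (rule Bochner_Integration.integrable_bound)
    show "integrable R (\<lambda>x. \<bar>S 0\<bar> + C * l1_norm x)"
      using l1 by auto
    show "S \<in> borel_measurable R"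
      by measurable
    have "\<bar>S x\<bar> \<le> \<bar>S 0\<bar> + C * l1_norm x" for x
      using S_diff_le[of x 0] C(2)[of x 0] by simp
    then show "AE x in R. norm (S x) \<le> norm (\<bar>S 0\<bar> + C * l1_norm x)"
      by (intro AE_I2) (smt (verit) real_norm_def)
  qed
qed

text \<open>The independent coupling ensures that the infimum defining \<open>W_score\<close> is
  over a nonempty set, so that minimizing sequences exist.\<close>

lemma couplings_nonempty: "P \<Otimes>\<^sub>M Q \<in> couplings P Q"
proof -
  interpret P: prob_space P using P by (simp add: prob_on_def)
  interpret Q: prob_space Q using Q by (simp add: prob_on_def)
  interpret PQ: pair_prob_space P Q ..
  have "distr (P \<Otimes>\<^sub>M Q) P fst = P"
    by (rule Q.distr_pair_fst)
  moreover have "distr (P \<Otimes>\<^sub>M Q) Q snd = Q"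
  proof (rule measure_eqI)
    fix A assume "A \<in> sets (distr (P \<Otimes>\<^sub>M Q) Q snd)"
    then have A: "A \<in> sets Q"
      by simp
    then have "snd -` A \<inter> space (P \<Otimes>\<^sub>M Q) = space P \<times> A"
      using sets.sets_into_space[OF A] by (auto simp: space_pair_measure)
    then show "emeasure (distr (P \<Otimes>\<^sub>M Q) Q snd) A = emeasure Q A"
      using A by (simp add: emeasure_distr Q.emeasure_pair_measure_Times P.emeasure_space_1)
  qed simp
  ultimately show ?thesis
    by (simp add: couplings_def PQ.prob_space_axioms)
qed

section \<open>Integrals against a fixed coupling\<close>

context
  fixes \<kappa> assumes \<kappa>: "\<kappa> \<in> couplings P Q"
begin

lemma sets_coupling [measurable_cong]: "sets \<kappa> = sets borel"
proof -
  have "sets \<kappa> = sets (P \<Otimes>\<^sub>M Q)"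
    using \<kappa> by (simp add: couplings_def)
  also have "\<dots> = sets borel"
    using P Q by (intro sets_pair_borel) (auto simp: prob_on_def)
  finally show ?thesis .
qed

lemma measurable_fst_coupling: "fst \<in> measurable \<kappa> P"
  and measurable_snd_coupling: "snd \<in> measurable \<kappa> Q"
  using \<kappa> by (auto simp: couplings_def cong: measurable_cong_sets)

lemma distr_coupling: "distr \<kappa> P fst = P" "distr \<kappa> Q snd = Q"
  using \<kappa> by (auto simp: couplings_def)

text \<open>Both marginals are concentrated on \<open>D\<close>. This is what allows the restriction
  to \<open>D \<times> D\<close> to be dropped from the integrals below.\<close>

lemma AE_coupling: "AE z in \<kappa>. z \<in> D \<times> D"
proof -
  have *: "AE x in R. x \<in> D" if "prob_on D R" for R
  proof -
    interpret prob_space R using that by (simp add: prob_on_def)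
    show ?thesis
      using that D by (intro AE_prob_1) (simp add: prob_on_def)
  qed
  have "AE x in distr \<kappa> P fst. x \<in> D"
    unfolding distr_coupling by (rule *[OF P])
  then have "AE z in \<kappa>. fst z \<in> D"
    by (rule AE_distrD[OF measurable_fst_coupling])
  moreover have "AE x in distr \<kappa> Q snd. x \<in> D"
    unfolding distr_coupling by (rule *[OF Q])
  then have "AE z in \<kappa>. snd z \<in> D"
    by (rule AE_distrD[OF measurable_snd_coupling])
  ultimately show ?thesis
    by eventually_elim (auto simp: mem_Times_iff)
qed

lemma integrable_fst_coupling:
  fixes f :: "real ^ 'n \<Rightarrow> real"
  assumes "integrable P f"
  shows "integrable \<kappa> (\<lambda>z. f (fst z))" and "(LINT z|\<kappa>. f (fst z)) = (LINT x|P. f x)"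
proof -
  have f: "f \<in> borel_measurable P"
    using assms by simp
  show "integrable \<kappa> (\<lambda>z. f (fst z))"
    using integrable_distr_eq[OF measurable_fst_coupling f] assms distr_coupling by simp
  show "(LINT z|\<kappa>. f (fst z)) = (LINT x|P. f x)"
    using integral_distr[OF measurable_fst_coupling f] distr_coupling by simp
qed

lemma integrable_snd_coupling:
  fixes f :: "real ^ 'n \<Rightarrow> real"
  assumes "integrable Q f"
  shows "integrable \<kappa> (\<lambda>z. f (snd z))" and "(LINT z|\<kappa>. f (snd z)) = (LINT x|Q. f x)"
proof -
  have f: "f \<in> borel_measurable Q"
    using assms by simp
  show "integrable \<kappa> (\<lambda>z. f (snd z))"
    using integrable_distr_eq[OF measurable_snd_coupling f] assms distr_coupling by simp
  show "(LINT z|\<kappa>. f (snd z)) = (LINT x|Q. f x)"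
    using integral_distr[OF measurable_snd_coupling f] distr_coupling by simp
qed

lemma integrable_d: "integrable \<kappa> (\<lambda>z. d (fst z) (snd z))"
proof -
  obtain C where C: "C \<ge> 0" "\<And>x y. d x y \<le> C * l1_norm (x - y)"
    using d_lipschitz by blast
  show ?thesis
  proof (rule Bochner_Integration.integrable_bound)
    show "integrable \<kappa> (\<lambda>z. C * (l1_norm (fst z) + l1_norm (snd z)))"
      using integrable_fst_coupling(1)[OF integrable_S(2)[OF P]]
        integrable_snd_coupling(1)[OF integrable_S(2)[OF Q]] by auto
    show "(\<lambda>z. d (fst z) (snd z)) \<in> borel_measurable \<kappa>"
      using measurable_d sets_coupling by (simp cong: measurable_cong_sets)
    have "d x y \<le> C * (l1_norm x + l1_norm y)" for x y
      using C(2)[of x y] mult_left_mono[OF l1_norm_diff[of x y] C(1)] by linarith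
    then show "AE z in \<kappa>. norm (d (fst z) (snd z)) \<le> norm (C * (l1_norm (fst z) + l1_norm (snd z)))"
      by (intro AE_I2) (smt (verit) d_nonneg real_norm_def)
  qed
qed

lemma set_integral_coupling:
  fixes f :: "(real ^ 'n) \<times> (real ^ 'n) \<Rightarrow> real"
  assumes "integrable \<kappa> f"
  shows "(LINT z:D \<times> D|\<kappa>. f z) = (LINT z|\<kappa>. f z)"
proof (rule set_integral_eq_integral_AE[OF AE_coupling])
  show "D \<times> D \<in> sets \<kappa>"
    using D sets_coupling by (metis borel_prod pair_measureI)
qed (use assms in simp)

text \<open>Each integrand depends on one coordinate, so only the marginals enter and the right-hand
  side is the same for every coupling.\<close>

lemma Delta_eq: "\<Delta> = (LINT z|\<kappa>. S (snd z)) - (LINT z|\<kappa>. S (fst z))"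
proof -
  have "(LINT x:D|R. S x) = (LINT x|R. S x)" if R: "prob_on D R" for R
  proof -
    interpret prob_space R using R by (simp add: prob_on_def)
    show ?thesis
      using R D integrable_S(1)[OF R]
      by (intro set_integral_eq_integral_AE AE_prob_1) (auto simp: prob_on_def)
  qed
  with P Q show ?thesis
    unfolding Delta_score_def
    by (simp add: integrable_fst_coupling(2) integrable_snd_coupling(2) integrable_S)
qed

lemma violation_eq:
  "(LINT z:D \<times> D|\<kappa>. (LINT \<theta>|L. max (s \<theta> (fst z) - s \<theta> (snd z)) 0)) = (cost \<kappa> - \<Delta>) / 2"
  and compensation_eq:
  "(LINT z:D \<times> D|\<kappa>. (LINT \<theta>|L. max (s \<theta> (snd z) - s \<theta> (fst z)) 0)) = (cost \<kappa> + \<Delta>) / 2"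
proof -
  note int = integrable_d integrable_fst_coupling(1)[OF integrable_S(1)[OF P]]
    integrable_snd_coupling(1)[OF integrable_S(1)[OF Q]]
  show "(LINT z:D \<times> D|\<kappa>. (LINT \<theta>|L. max (s \<theta> (fst z) - s \<theta> (snd z)) 0)) = (cost \<kappa> - \<Delta>) / 2"
    unfolding positive_part_integral using int
    by (subst set_integral_coupling) (auto simp: Delta_eq)
  show "(LINT z:D \<times> D|\<kappa>. (LINT \<theta>|L. max (s \<theta> (snd z) - s \<theta> (fst z)) 0)) = (cost \<kappa> + \<Delta>) / 2"
    unfolding positive_part_integral d_commute[of "snd _"] using int
    by (subst set_integral_coupling) (auto simp: Delta_eq)
qed

text \<open>Violation and compensation are integrals of nonnegative functions, which bounds
  \<open>\<Delta>\<close> from both sides.\<close>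

lemma abs_Delta_le_cost: "\<bar>\<Delta>\<bar> \<le> cost \<kappa>"
proof -
  have "0 \<le> (cost \<kappa> - \<Delta>) / 2"
    unfolding violation_eq[symmetric] set_lebesgue_integral_def
    by (intro Bochner_Integration.integral_nonneg) auto
  moreover have "0 \<le> (cost \<kappa> + \<Delta>) / 2"
    unfolding compensation_eq[symmetric] set_lebesgue_integral_def
    by (intro Bochner_Integration.integral_nonneg) auto
  ultimately show ?thesis
    by auto
qed

end

section \<open>Dominance as an inequality of costs, and minimizing couplings\<close>

lemma CSD_iff: "CSD L s D \<gamma> P Q \<longleftrightarrow> (\<exists>\<kappa>\<in>couplings P Q. cost \<kappa> - \<Delta> \<le> \<gamma> * (cost \<kappa> + \<Delta>))"
  unfolding CSD_def by (intro bex_cong refl) (auto simp: violation_eq compensation_eq)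

abbreviation "W \<equiv> W_score L s D P Q"

lemma W_eq: "W = (INF \<kappa>\<in>couplings P Q. cost \<kappa>)"
  unfolding W_score_def by (intro INF_cong refl set_integral_coupling integrable_d)

lemma cost_nonneg: "0 \<le> cost \<kappa>"
  by (intro Bochner_Integration.integral_nonneg d_nonneg)

lemma W_le_cost: "\<kappa> \<in> couplings P Q \<Longrightarrow> W \<le> cost \<kappa>"
  unfolding W_eq by (intro cINF_lower bdd_belowI2[of _ 0]) (auto intro: cost_nonneg)

lemma cost_sequence:
  obtains \<kappa> where "\<And>n::nat. \<kappa> n \<in> couplings P Q" "(\<lambda>n. cost (\<kappa> n)) \<longlonglongrightarrow> W"
proof -
  have "\<exists>\<kappa>\<in>couplings P Q. cost \<kappa> < W + inverse (real (Suc n))" for n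
    using couplings_nonempty
    by (subst cINF_less_iff[symmetric]) (auto simp: W_eq intro!: bdd_belowI2[of _ 0] cost_nonneg)
  then obtain \<kappa> where \<kappa>: "\<And>n. \<kappa> n \<in> couplings P Q" "\<And>n. cost (\<kappa> n) < W + inverse (real (Suc n))"
    by metis
  have "(\<lambda>n. cost (\<kappa> n)) \<longlonglongrightarrow> W"
  proof (rule tendsto_sandwich[OF _ _ tendsto_const LIMSEQ_inverse_real_of_nat_add])
    show "\<forall>\<^sub>F n in sequentially. W \<le> cost (\<kappa> n)"
      using \<kappa>(1) by (intro always_eventually allI W_le_cost)
    show "\<forall>\<^sub>F n in sequentially. cost (\<kappa> n) \<le> W + inverse (real (Suc n))"
      using \<kappa>(2) by (intro always_eventually allI less_imp_le)
  qed
  with \<kappa>(1) show ?thesis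
    using that by blast
qed

text \<open>Without attainment the value at \<open>W = 0\<close> would be 1 instead of 0, since then \<open>\<Delta> = 0\<close>
  and every coupling of positive cost has violation equal to compensation.\<close>
lemma W_zero_attained:
  assumes "W = 0"
  obtains \<mu> where "\<mu> \<in> couplings P Q" "cost \<mu> = 0"
proof -
  obtain \<kappa> where \<kappa>: "\<And>n::nat. \<kappa> n \<in> couplings P Q" and "(\<lambda>n. cost (\<kappa> n)) \<longlonglongrightarrow> W"
    by (rule cost_sequence) auto
  then have lim: "(\<lambda>n. cost (\<kappa> n)) \<longlonglongrightarrow> 0"
    using assms by simp
  obtain \<mu> where \<mu>: "\<mu> \<in> couplings P Q"
    and limsup: "\<And>U c. open U \<Longrightarrow> (\<lambda>n. measure (\<kappa> n) U) \<longlonglongrightarrow> c \<Longrightarrow> measure \<mu> U \<le> c"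
    by (rule couplings_cluster_point[where P = P and Q = Q and \<kappa> = \<kappa>])
      (use P Q \<kappa> in \<open>auto simp: prob_on_def\<close>)
  interpret \<mu>: prob_space \<mu>
    using \<mu> by (simp add: couplings_def)
  have AE: "AE z in \<mu>. d (fst z) (snd z) \<le> e" if "e > 0" for e
  proof -
    \<comment> \<open>The strict inequality makes the set open, so that \<open>limsup\<close>
      applies. Markov's inequality bounds its mass under \<open>\<kappa> n\<close> by
      \<open>cost (\<kappa> n) / e\<close>, which tends to 0.\<close>
    let ?U = "{z. e < d (fst z) (snd z)}"
    have U: "open ?U"
      by (intro open_Collect_less continuous_d continuous_on_const)
    have Markov: "measure (\<kappa> n) ?U \<le> cost (\<kappa> n) / e" for n
    proof -
      interpret prob_space "\<kappa> n"
        using \<kappa>[of n] by (simp add: couplings_def)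
      note sets = sets_coupling[OF \<kappa>[of n]]
      have space: "space (\<kappa> n) = UNIV"
        using sets_eq_imp_space_eq[OF sets] by simp
      have "measure (\<kappa> n) ?U \<le> measure (\<kappa> n) {z \<in> space (\<kappa> n). e \<le> d (fst z) (snd z)}"
      proof (rule finite_measure_mono)
        have "closed {z. e \<le> d (fst z) (snd z)}"
          by (intro closed_Collect_le continuous_d continuous_on_const)
        then show "{z \<in> space (\<kappa> n). e \<le> d (fst z) (snd z)} \<in> sets (\<kappa> n)"
          unfolding space sets by simp
      qed (auto simp: space)
      also have "\<dots> \<le> cost (\<kappa> n) / e"
        using integrable_d[OF \<kappa>[of n]] \<open>e > 0\<close> d_nonneg
        by (intro integral_Markov_inequality_measure[where A = "{}"]) auto
      finally show ?thesis .
    qed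
    have "(\<lambda>n. cost (\<kappa> n) / e) \<longlonglongrightarrow> 0"
      using tendsto_divide[OF lim tendsto_const, of e] \<open>e > 0\<close> by simp
    then have "(\<lambda>n. measure (\<kappa> n) ?U) \<longlonglongrightarrow> 0"
      by (rule tendsto_sandwich[OF _ _ tendsto_const, rotated 2])
        (intro always_eventually allI Markov measure_nonneg)+
    then have "measure \<mu> ?U \<le> 0"
      by (rule limsup[OF U])
    then have "measure \<mu> ?U = 0"
      using measure_nonneg[of \<mu> ?U] by linarith
    then have "?U \<in> null_sets \<mu>"
      using U sets_coupling[OF \<mu>] by (auto simp: null_sets_def \<mu>.emeasure_eq_measure)
    from AE_not_in[OF this] show ?thesis
      by eventually_elim simp
  qed
  have "AE z in \<mu>. \<forall>k. d (fst z) (snd z) \<le> inverse (real (Suc k))"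
    unfolding AE_all_countable by (intro allI AE) simp
  then have "AE z in \<mu>. d (fst z) (snd z) = 0"
  proof eventually_elim
    case (elim z)
    then have "d (fst z) (snd z) \<le> 0"
      by (intro LIMSEQ_le_const[OF LIMSEQ_inverse_real_of_nat]) blast
    then show ?case
      using d_nonneg by (intro antisym)
  qed
  then have "cost \<mu> = 0"
    by (rule integral_eq_zero_AE)
  with \<mu> show ?thesis
    using that by blast
qed

section \<open>The three cases of the formula\<close>

lemma gamma_star_nonneg: "0 \<le> gamma_star L s D P Q"
  unfolding gamma_star_def by (intro Inf_greatest) auto

text \<open>A coupling of cost 0 forces \<open>\<Delta> = 0\<close>; its violation then vanishes, so
  dominance holds already at level 0.\<close>

lemma gamma_star_W_zero:
  assumes "W = 0"
  shows "gamma_star L s D P Q = 0"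
proof -
  obtain \<mu> where \<mu>: "\<mu> \<in> couplings P Q" "cost \<mu> = 0"
    using W_zero_attained[OF assms] .
  then have "\<Delta> = 0"
    using abs_Delta_le_cost[OF \<mu>(1)] by simp
  with \<mu> have "CSD L s D 0 P Q"
    unfolding CSD_iff by force
  then have "gamma_star L s D P Q \<le> ereal 0"
    unfolding gamma_star_def by (intro Inf_lower imageI) auto
  with gamma_star_nonneg show ?thesis
    by (simp add: zero_ereal_def antisym)
qed

text \<open>With a level at most 1 and nonnegative compensation, dominance would give
  \<open>cost \<kappa> - \<Delta> \<le> cost \<kappa> + \<Delta>\<close>, that is
  \<open>\<Delta> \<ge> 0\<close>. The infimum is therefore over the empty set.\<close>

lemma gamma_star_Delta_neg:
  assumes "\<Delta> < 0"
  shows "gamma_star L s D P Q = \<infinity>"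
proof -
  have "\<not> CSD L s D \<gamma> P Q" if "\<gamma> \<in> {0..1}" for \<gamma>
  proof
    assume "CSD L s D \<gamma> P Q"
    then obtain \<kappa> where \<kappa>: "\<kappa> \<in> couplings P Q" "cost \<kappa> - \<Delta> \<le> \<gamma> * (cost \<kappa> + \<Delta>)"
      unfolding CSD_iff by blast
    have "\<gamma> * (cost \<kappa> + \<Delta>) \<le> 1 * (cost \<kappa> + \<Delta>)"
      using that abs_Delta_le_cost[OF \<kappa>(1)] by (intro mult_right_mono) auto
    with \<kappa> assms show False
      by simp
  qed
  then have empty: "{\<gamma> \<in> {0..1}. CSD L s D \<gamma> P Q} = {}"
    by blast
  show ?thesis
    unfolding gamma_star_def empty by (simp add: top_ereal_def)
qed

lemma gamma_star_Delta_nonneg: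
  assumes W: "W > 0" and \<Delta>: "\<Delta> \<ge> 0"
  shows "gamma_star L s D P Q = ereal ((W - \<Delta>) / (W + \<Delta>))"
proof (rule antisym)
  show "ereal ((W - \<Delta>) / (W + \<Delta>)) \<le> gamma_star L s D P Q"
    unfolding gamma_star_def
  proof (rule Inf_greatest)
    fix g assume "g \<in> ereal ` {\<gamma> \<in> {0..1}. CSD L s D \<gamma> P Q}"
    then obtain \<gamma> \<kappa> where g: "g = ereal \<gamma>" "0 \<le> \<gamma>" "\<gamma> \<le> 1" and \<kappa>: "\<kappa> \<in> couplings P Q"
      and le: "cost \<kappa> - \<Delta> \<le> \<gamma> * (cost \<kappa> + \<Delta>)"
      unfolding CSD_iff by auto
    \<comment> \<open>Dominance rearranges to \<open>(1 - \<gamma>) * cost \<kappa> \<le> (1 +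
      \<gamma>) * \<Delta>\<close>; as \<open>\<gamma> \<le> 1\<close>, the cost may be lowered to
      \<open>W\<close>.\<close>
    have "(1 - \<gamma>) * W \<le> (1 - \<gamma>) * cost \<kappa>"
      using g W_le_cost[OF \<kappa>] by (intro mult_left_mono) auto
    with le have "W - \<Delta> \<le> \<gamma> * (W + \<Delta>)"
      by (simp add: algebra_simps)
    then show "ereal ((W - \<Delta>) / (W + \<Delta>)) \<le> g"
      using W \<Delta> g by (simp add: pos_divide_le_eq)
  qed
next
  obtain \<kappa> where \<kappa>: "\<And>n::nat. \<kappa> n \<in> couplings P Q" and lim: "(\<lambda>n. cost (\<kappa> n)) \<longlonglongrightarrow> W"
    by (rule cost_sequence) auto
  \<comment> \<open>The level at which the coupling \<open>\<kappa> n\<close> satisfies the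
    dominance inequality with equality. It lies in \<open>{0..1}\<close> because
    \<open>0 \<le> \<Delta> \<le> cost (\<kappa> n)\<close>, and it converges because
    \<open>W + \<Delta> > 0\<close>.\<close>
  let ?g = "\<lambda>n. (cost (\<kappa> n) - \<Delta>) / (cost (\<kappa> n) + \<Delta>)"
  have le: "gamma_star L s D P Q \<le> ereal (?g n)" for n
    unfolding gamma_star_def
  proof (rule Inf_lower, rule imageI)
    have pos: "0 < cost (\<kappa> n) + \<Delta>"
      using W_le_cost[OF \<kappa>[of n]] W \<Delta> by linarith
    moreover have "0 \<le> cost (\<kappa> n) - \<Delta>"
      using abs_Delta_le_cost[OF \<kappa>[of n]] by simp
    ultimately have "?g n \<in> {0..1}"
      using \<Delta> by (simp add: pos_divide_le_eq)
    moreover have "CSD L s D (?g n) P Q"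
      unfolding CSD_iff using pos by (intro bexI[OF _ \<kappa>[of n]]) simp
    ultimately show "?g n \<in> {\<gamma> \<in> {0..1}. CSD L s D \<gamma> P Q}"
      by simp
  qed
  have "?g \<longlonglongrightarrow> (W - \<Delta>) / (W + \<Delta>)"
    using lim W \<Delta> by (intro tendsto_intros) auto
  then have "(\<lambda>n. ereal (?g n)) \<longlonglongrightarrow> ereal ((W - \<Delta>) / (W + \<Delta>))"
    by (intro tendsto_ereal)
  then show "gamma_star L s D P Q \<le> ereal ((W - \<Delta>) / (W + \<Delta>))"
    by (rule LIMSEQ_le_const) (use le in blast)
qed

end

theorem corollary2p5:
  fixes L :: "'t measure"
    and s :: "'t \<Rightarrow> real ^ 'n \<Rightarrow> real"
    and D :: "(real ^ 'n) set"
    and P Q :: "(real ^ 'n) measure"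
  assumes "D \<in> sets borel" and "D \<noteq> {}"
    and "score_family L s"
    and "prob_on D P" and "prob_on D Q"
  shows "(W_score L s D P Q = 0 \<longrightarrow> gamma_star L s D P Q = 0) \<and>
    (W_score L s D P Q > 0 \<and> Delta_score L s D P Q \<ge> 0 \<longrightarrow>
       gamma_star L s D P Q =
         ereal ((W_score L s D P Q - Delta_score L s D P Q) /
                (W_score L s D P Q + Delta_score L s D P Q))) \<and>
    (Delta_score L s D P Q < 0 \<longrightarrow> gamma_star L s D P Q = \<infinity>)"
proof -
  interpret score_couplings L s D P Q
    using assms by unfold_locales
  show ?thesis
    using gamma_star_W_zero gamma_star_Delta_nonneg gamma_star_Delta_neg by blast
qed

end
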